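(* Suppose that either $f=h+g$ or $f=h+\overline{g}$, where $h(z)=\sum_{n=1}^\infty a_n z^n$ and $g(z)=\sum_{n=1}^\infty b_n z^n$ are bounded analytic functions in the unit disk $\mathbb{D}$. Then $$\sum_{n=1}^\infty(|a_n|+|b_n|)r^n\le\max\{\|h\|_\infty,\|g\|_\infty\}\quad\text{for } 0\le r\le\sqrt{\frac{7}{32}}.$$ The number $\sqrt{7/32}$ is sharp, i.e. for every $r\in(\sqrt{7/32},1)$ there are such $h,g$ for which the inequality fails at $r$.
   Context: $\mathbb{D}=\{z\in\mathbb{C}:|z|<1\}$ and $\|h\|_\infty=\sup_{z\in\mathbb{D}}|h(z)|$, $\|g\|_\infty=\sup_{z\in\mathbb{D}}|g(z)|$. *)

theory Defs
  imports "HOL-Complex_Analysis.Complex_Analysis"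
begin

abbreviation unit_disk :: "complex set" where
  "unit_disk \<equiv> ball 0 1"

(* A real supremum: meaningful only for functions that are bounded on the disk. *)
definition disk_sup_norm :: "(complex \<Rightarrow> complex) \<Rightarrow> real" where
  "disk_sup_norm h = (SUP z\<in>unit_disk. norm (h z))"

(* The power series starts at n = 1, so the value a 0 is never used. *)
definition bounded_analytic_series :: "(nat \<Rightarrow> complex) \<Rightarrow> (complex \<Rightarrow> complex) \<Rightarrow> bool" where
  "bounded_analytic_series a h \<longleftrightarrow>
     h analytic_on unit_disk \<and>
     bounded (h ` unit_disk) \<and>
     (\<forall>z\<in>unit_disk. (\<lambda>n. a (Suc n) * z ^ Suc n) sums h z)"

end

theory Submission
  imports Defs
begin

text \<open>
  Write \<open>h(z) = z \<phi>(z)\<close>. By the Schwarz lemma \<open>\<phi>\<close> has the same bound as \<open>h\<close>, and after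
  scaling one may assume \<open>|\<phi>| < 1\<close>. Since the average of \<open>\<parallel>h\<parallel>\<close> and \<open>\<parallel>g\<parallel>\<close> is at most their
  maximum, the inequality follows once each series alone is bounded by half the norm, that is, once
  \<open>\<Sum> |c\<^sub>n| r\<^sup>n\<^sup>+\<^sup>1 \<le> 1/2\<close> for the Taylor coefficients \<open>c\<^sub>n\<close> of \<open>\<phi>\<close> and \<open>r\<^sup>2 = 7/32\<close>.

  This is the value of Bombieri's refinement of Bohr's inequality at that radius. The estimate
  starts from the Schwarz--Pick inequality \<open>|\<phi>(z) - c\<^sub>0| \<le> |z| |1 - cnj c\<^sub>0 \<phi>(z)|\<close>. With
  \<open>\<psi> = \<phi> - c\<^sub>0\<close> and \<open>\<alpha> = |c\<^sub>0|\<close> its right-hand side is \<open>|z| |1 - \<alpha>\<^sup>2 - cnj c\<^sub>0 \<psi>(z)|\<close>, and as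
  \<open>\<psi>(0) = 0\<close>, taking mean squares over the circle \<open>|z| = q\<close> turns it into
  \<open>(1 - q\<^sup>2 \<alpha>\<^sup>2) \<Sum>\<^sub>k\<^sub>\<ge>\<^sub>1 |c\<^sub>k|\<^sup>2 q\<^sup>2\<^sup>k \<le> q\<^sup>2 (1 - \<alpha>\<^sup>2)\<^sup>2\<close> (\<open>sum_coeff_squares_le\<close>).
  A weighted Cauchy--Schwarz inequality then bounds \<open>\<Sum> |c\<^sub>k| r\<^sup>k\<^sup>+\<^sup>1\<close> by an explicit function of
  \<open>t = r \<alpha>\<close> (\<open>sum_norm_coeff_le_half\<close>). That function touches the value \<open>1/2\<close> at \<open>t = 3/8\<close> and
  stays below it elsewhere (\<open>tangent_bound_at_three_eighths\<close>).

  The point of contact \<open>\<alpha> = 3 / sqrt 14\<close> also names the extremal function: for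
  \<open>h = g = z (s - z) / (1 - s z)\<close> with \<open>s = 3 / sqrt 14\<close> every step is an equality at
  \<open>r\<^sup>2 = 7/32\<close>, and the sum increases strictly in \<open>r\<close>.
\<close>

section \<open>Mean squares of coefficients\<close>

text \<open>
  Parseval's identity, with the mean over the \<open>M\<close>-th roots of unity in place of an integral over
  the circle: for a polynomial of degree below \<open>M\<close> this discrete mean is exact.
\<close>
lemma sum_roots_unity_parseval:
  fixes d :: "nat \<Rightarrow> complex"
  assumes "M > 0"
  shows "(\<Sum>j<M. (norm (\<Sum>k<M. d k * cis (2 * pi * real j / real M) ^ k))\<^sup>2)
         = real M * (\<Sum>k<M. (norm (d k))\<^sup>2)"
proof -
  define w where "w k = cis (2 * pi * real k / real M)" for k :: nat
  have bij: "bij_betw w {..<M} {z. z ^ M = 1}"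
    unfolding w_def using Complex.bij_betw_roots_unity[OF assms] .
  have inj: "inj_on w {..<M}" and root: "w k ^ M = 1" if "k < M" for k
    using bij that by (auto simp: bij_betw_def)
  have w_nz: "w k \<noteq> 0" for k
    by (simp add: w_def)
  have cnj_w: "cnj (w k) = inverse (w k)" for k
    by (simp add: w_def cis_cnj)
  have w_swap: "w j ^ k = w k ^ j" for j k
    by (simp add: w_def Complex.DeMoivre mult_ac)
  have orth: "(\<Sum>j<M. w j ^ k * cnj (w j ^ l)) = (if k = l then of_nat M else 0)"
    if "k < M" "l < M" for k l
  proof -
    have "(\<Sum>j<M. w j ^ k * cnj (w j ^ l)) = (\<Sum>j<M. (w k / w l) ^ j)"
      by (intro sum.cong refl)
        (metis cnj_w complex_cnj_power divide_inverse power_inverse power_mult_distrib w_swap)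
    also have "\<dots> = (if k = l then of_nat M else 0)"
    proof (cases "k = l")
      case False
      have "w k \<noteq> w l"
        using False inj that by (auto simp: inj_on_def)
      then have "w k / w l \<noteq> 1"
        using w_nz by simp
      then have "(\<Sum>j<M. (w k / w l) ^ j) = ((w k / w l) ^ M - 1) / (w k / w l - 1)"
        by (rule geometric_sum)
      also have "(w k / w l) ^ M = 1"
        using root that by (simp add: power_divide)
      finally show ?thesis
        using False by simp
    qed (use w_nz in simp)
    finally show ?thesis .
  qed
  have "complex_of_real (\<Sum>j<M. (norm (\<Sum>k<M. d k * w j ^ k))\<^sup>2)
      = (\<Sum>j<M. (\<Sum>k<M. d k * w j ^ k) * cnj (\<Sum>l<M. d l * w j ^ l))"
    by (simp add: complex_norm_square del: of_real_power)
  also have "\<dots> = (\<Sum>j<M. \<Sum>k<M. \<Sum>l<M. d k * cnj (d l) * (w j ^ k * cnj (w j ^ l)))"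
    by (simp add: sum_product mult_ac)
  also have "\<dots> = (\<Sum>k<M. \<Sum>l<M. \<Sum>j<M. d k * cnj (d l) * (w j ^ k * cnj (w j ^ l)))"
    by (rule trans[OF sum.swap], rule sum.cong[OF refl], rule sum.swap)
  also have "\<dots> = (\<Sum>k<M. \<Sum>l<M. d k * cnj (d l) * (if k = l then of_nat M else 0))"
    by (intro sum.cong refl) (simp only: sum_distrib_left[symmetric] orth lessThan_iff)
  also have "\<dots> = (\<Sum>k<M. d k * cnj (d k) * of_nat M)"
    by (intro sum.cong refl) (simp add: if_distrib sum.delta cong: if_cong)
  also have "\<dots> = complex_of_real (real M * (\<Sum>k<M. (norm (d k))\<^sup>2))"
    by (simp add: complex_norm_square sum_distrib_left mult_ac del: of_real_power)
  finally show ?thesis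
    unfolding w_def of_real_eq_iff .
qed

text \<open>
  The Schwarz lemma for \<open>\<phi>\<close> followed by the disc automorphism sending \<open>\<phi> 0\<close> to \<open>0\<close>. The form
  without a quotient is the one whose two sides can be compared in mean square.
\<close>
lemma schwarz_pick_at_0:
  assumes hol: "\<phi> holomorphic_on unit_disk"
    and lt1: "\<And>z. norm z < 1 \<Longrightarrow> norm (\<phi> z) < 1"
    and z: "norm z < 1"
  shows "norm (\<phi> z - \<phi> 0) \<le> norm z * norm (1 - cnj (\<phi> 0) * \<phi> z)"
proof -
  define \<omega> where "\<omega> = Moebius_function 0 (\<phi> 0) \<circ> \<phi>"
  have "\<omega> holomorphic_on unit_disk"
    unfolding \<omega>_def using lt1
    by (intro holomorphic_on_compose_gen[OF hol Moebius_function_holomorphic]) auto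
  moreover have "\<omega> 0 = 0"
    by (simp add: \<omega>_def Moebius_function_eq_zero)
  moreover have "norm (\<omega> \<zeta>) < 1" if "norm \<zeta> < 1" for \<zeta>
    using lt1 that by (simp add: \<omega>_def Moebius_function_norm_lt_1)
  ultimately have le: "norm (\<omega> z) \<le> norm z"
    using Schwarz_Lemma(1) z by blast
  have "norm (cnj (\<phi> 0) * \<phi> z) < 1"
    using lt1[of 0] lt1[OF z] mult_strict_mono[of "norm (\<phi> 0)" 1 "norm (\<phi> z)" 1]
    by (simp add: norm_mult)
  then have "1 - cnj (\<phi> 0) * \<phi> z \<noteq> 0"
    by auto
  then show ?thesis
    using le by (simp add: \<omega>_def Moebius_function_simple norm_divide divide_le_eq)
qed

text \<open>
  Squaring the Schwarz--Pick inequality and averaging over \<open>|z| = q\<close> gives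
  \<open>S \<le> q\<^sup>2 (K\<^sup>2 + \<alpha>\<^sup>2 S)\<close>, where \<open>S\<close> is the mean square of \<open>\<phi> - c 0\<close>, \<open>\<alpha> = |c 0|\<close> and
  \<open>K = 1 - \<alpha>\<^sup>2\<close>: the cross term has mean zero because \<open>\<phi> - c 0\<close> vanishes at \<open>0\<close>. Solving for \<open>S\<close>
  gives the claim. To use finite means only, \<open>\<phi> - c 0\<close> is replaced by its Taylor polynomials; the
  error is at most the tail \<open>e\<close> of \<open>\<Sum> |c\<^sub>n| q\<^sup>n\<close>, uniformly on the circle.
\<close>
lemma sum_coeff_squares_le:
  fixes c :: "nat \<Rightarrow> complex"
  assumes sums: "\<And>z. norm z < 1 \<Longrightarrow> (\<lambda>n. c n * z ^ n) sums \<phi> z"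
    and lt1: "\<And>z. norm z < 1 \<Longrightarrow> norm (\<phi> z) < 1"
    and q: "0 < q" "q < 1"
  shows "(1 - q\<^sup>2 * (norm (c 0))\<^sup>2) * (\<Sum>k<N. (norm (c (Suc k)) * q ^ Suc k)\<^sup>2)
         \<le> q\<^sup>2 * (1 - (norm (c 0))\<^sup>2)\<^sup>2"
proof -
  define \<alpha> where "\<alpha> = norm (c 0)"
  define K where "K = 1 - \<alpha>\<^sup>2"
  define f where "f n = norm (c n) * q ^ n" for n
  define B where "B = suminf f"
  define e where "e M = B - (\<Sum>k<M. f k)" for M
  define S where "S n = (\<Sum>k<n. (f (Suc k))\<^sup>2)" for n
  have \<phi>0: "\<phi> 0 = c 0"
    using sums[of 0] by (simp add: sums_iff powser_zero)
  have hol: "\<phi> holomorphic_on unit_disk"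
    using sums by (intro power_series_holomorphic[where a = c]) (auto simp: dist_norm)
  have \<alpha>: "0 \<le> \<alpha>" "\<alpha> < 1"
    using lt1[of 0] by (auto simp: \<alpha>_def \<phi>0)
  have K: "0 < K" "K \<le> 1"
    using \<alpha> by (auto simp: K_def power_less_one_iff)
  have summ: "summable f"
  proof -
    have "summable (\<lambda>n. c n * of_real ((q + 1) / 2) ^ n)"
      using q by (intro sums_summable[OF sums]) simp
    then have "summable (\<lambda>n. norm (c n * of_real q ^ n))"
      by (rule powser_insidea) (use q in \<open>simp only: norm_of_real; simp\<close>)
    then show ?thesis
      using q by (simp add: f_def [abs_def] norm_mult norm_power)
  qed
  have fpos: "0 \<le> f n" for n
    using q by (simp add: f_def)
  have e0: "0 \<le> e M" for M
    using sum_le_suminf[OF summ, of "{..<M}"] fpos by (simp add: e_def B_def)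
  have e_lim: "e \<longlonglongrightarrow> 0"
    using tendsto_diff[OF tendsto_const summable_LIMSEQ[OF summ], of B]
    by (simp add: e_def [abs_def] B_def)
  have B0: "0 \<le> B"
    unfolding B_def by (rule suminf_nonneg[OF summ fpos])
  have pointwise: "(norm (\<Sum>k<Suc n. (if k = 0 then 0 else c k) * z ^ k))\<^sup>2
      \<le> q\<^sup>2 * (norm (\<Sum>k<Suc n. (if k = 0 then of_real K else - cnj (c 0) * c k) * z ^ k))\<^sup>2
        + (4 * e (Suc n) * (1 + B) + 4 * (e (Suc n))\<^sup>2)"
    if z: "norm z = q" for z n
  proof -
    define E where "E = e (Suc n)"
    define P where "P = (\<Sum>k<n. c (Suc k) * z ^ Suc k)"
    have z1: "norm z < 1" using z q by simp
    have P1: "(\<Sum>k<Suc n. (if k = 0 then 0 else c k) * z ^ k) = P"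
      by (simp add: P_def sum.lessThan_Suc_shift del: sum.lessThan_Suc)
    have P2: "(\<Sum>k<Suc n. (if k = 0 then of_real K else - cnj (c 0) * c k) * z ^ k)
              = of_real K - cnj (c 0) * P"
      by (simp add: P_def sum.lessThan_Suc_shift sum_distrib_left sum_negf mult_ac del: sum.lessThan_Suc)
    have nf: "norm (c k * z ^ k) = f k" for k
      by (simp add: f_def norm_mult norm_power z)
    have "norm P \<le> (\<Sum>k<n. f (Suc k))"
      unfolding P_def by (rule order_trans[OF norm_sum]) (simp only: nf order_refl)
    also have "\<dots> \<le> (\<Sum>k<Suc n. f k)"
      using fpos[of 0] by (simp add: sum.lessThan_Suc_shift del: sum.lessThan_Suc)
    also have "\<dots> \<le> B"
      using e0[of "Suc n"] by (simp add: e_def)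
    finally have PB: "norm P \<le> B" .
    have tail: "(\<Sum>k. c (k + Suc n) * z ^ (k + Suc n)) = \<phi> z - (\<Sum>k<Suc n. c k * z ^ k)"
      using suminf_minus_initial_segment[OF sums_summable[OF sums[OF z1]], of "Suc n"]
      by (simp only: sums_unique[OF sums[OF z1], symmetric])
    have head: "(\<Sum>k<Suc n. c k * z ^ k) = c 0 + P"
      by (simp add: P_def sum.lessThan_Suc_shift del: sum.lessThan_Suc)
    have tail_le: "norm (\<Sum>k. c (k + Suc n) * z ^ (k + Suc n)) \<le> E"
    proof -
      have s: "summable (\<lambda>k. f (k + Suc n))"
        using summ by (rule summable_ignore_initial_segment)
      have "norm (\<Sum>k. c (k + Suc n) * z ^ (k + Suc n))
          \<le> (\<Sum>k. norm (c (k + Suc n) * z ^ (k + Suc n)))"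
        by (rule summable_norm) (simp only: nf s)
      also have "\<dots> = E"
        unfolding nf E_def e_def B_def by (rule suminf_minus_initial_segment[OF summ])
      finally show ?thesis .
    qed
    have err: "norm (\<phi> z - c 0 - P) \<le> E"
      using tail_le unfolding tail head by (simp only: diff_diff_eq)
    \<comment> \<open>The inequality for \<open>\<phi> z - c 0\<close> passes to its Taylor polynomial \<open>P\<close>: each side costs one \<open>E\<close>.\<close>
    have "norm (\<phi> z - c 0) \<le> q * norm (1 - cnj (c 0) * \<phi> z)"
      using schwarz_pick_at_0[OF hol lt1 z1] z \<phi>0 by simp
    also have "1 - cnj (c 0) * \<phi> z = (of_real K - cnj (c 0) * P) - cnj (c 0) * (\<phi> z - c 0 - P)"
      by (simp add: K_def \<alpha>_def complex_norm_square algebra_simps del: of_real_power)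
    also have "norm \<dots> \<le> norm (of_real K - cnj (c 0) * P) + \<alpha> * norm (\<phi> z - c 0 - P)"
      by (rule order_trans[OF norm_triangle_ineq4]) (simp add: norm_mult \<alpha>_def)
    also have "\<dots> \<le> norm (of_real K - cnj (c 0) * P) + 1 * E"
      using err \<alpha> by (intro add_mono mult_mono) auto
    finally have "norm (\<phi> z - c 0) \<le> q * norm (of_real K - cnj (c 0) * P) + q * E"
      using q by (simp add: distrib_left)
    moreover have "q * E \<le> E"
      using q e0 by (simp add: E_def mult_left_le_one_le)
    moreover have "norm P \<le> norm (\<phi> z - c 0) + norm (\<phi> z - c 0 - P)"
      using norm_triangle_ineq4[of "\<phi> z - c 0" "\<phi> z - c 0 - P"] by simp
    ultimately have x: "norm P \<le> q * norm (of_real K - cnj (c 0) * P) + 2 * E"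
      using err by linarith
    define y where "y = q * norm (of_real K - cnj (c 0) * P)"
    have y0: "0 \<le> y" using q by (simp add: y_def)
    have "norm (of_real K - cnj (c 0) * P) \<le> K + \<alpha> * norm P"
      by (rule order_trans[OF norm_triangle_ineq4]) (use K in \<open>simp add: norm_mult \<alpha>_def\<close>)
    also have "\<dots> \<le> 1 + 1 * B"
      using K \<alpha> PB by (intro add_mono mult_mono) auto
    finally have "norm (of_real K - cnj (c 0) * P) \<le> 1 + B" by simp
    then have yB: "y \<le> 1 + B"
      unfolding y_def using q mult_left_le_one_le[of "norm (of_real K - cnj (c 0) * P)" q]
      by simp
    have E0: "0 \<le> E" by (simp add: E_def e0)
    have "(norm P)\<^sup>2 \<le> (y + 2 * E)\<^sup>2"
      using x by (intro power_mono) (auto simp: y_def)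
    also have "\<dots> = y\<^sup>2 + 4 * E * y + 4 * E\<^sup>2"
      by (simp add: power2_eq_square algebra_simps)
    also have "\<dots> \<le> y\<^sup>2 + 4 * E * (1 + B) + 4 * E\<^sup>2"
      using mult_left_mono[OF yB, of "4 * E"] E0 by simp
    finally show ?thesis
      unfolding P1 P2 E_def[symmetric] by (simp add: y_def power_mult_distrib)
  qed
  have bound: "(1 - q\<^sup>2 * \<alpha>\<^sup>2) * S n
      \<le> q\<^sup>2 * K\<^sup>2 + (4 * e (Suc n) * (1 + B) + 4 * (e (Suc n))\<^sup>2)" for n
  proof -
    define \<delta> where "\<delta> = 4 * e (Suc n) * (1 + B) + 4 * (e (Suc n))\<^sup>2"
    define w where "w j = cis (2 * pi * real j / real (Suc n))" for j :: nat
    \<comment> \<open>Both sides are polynomials of degree at most \<open>n\<close>, so \<open>Suc n\<close> points suffice.\<close>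
    have parseval: "(\<Sum>j<Suc n. (norm (\<Sum>k<Suc n. d k * (of_real q * w j) ^ k))\<^sup>2)
        = real (Suc n) * (\<Sum>k<Suc n. (norm (d k) * q ^ k)\<^sup>2)" for d
      using sum_roots_unity_parseval[of "Suc n" "\<lambda>k. d k * of_real q ^ k"] q
      unfolding w_def[symmetric]
      by (simp add: power_mult_distrib norm_mult norm_power mult.assoc del: sum.lessThan_Suc of_nat_Suc)
    have "real (Suc n) * S n
        = (\<Sum>j<Suc n. (norm (\<Sum>k<Suc n. (if k = 0 then 0 else c k) * (of_real q * w j) ^ k))\<^sup>2)"
      unfolding parseval by (simp add: S_def f_def sum.lessThan_Suc_shift del: sum.lessThan_Suc)
    also have "\<dots> \<le> (\<Sum>j<Suc n. q\<^sup>2 * (norm (\<Sum>k<Suc n.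
        (if k = 0 then of_real K else - cnj (c 0) * c k) * (of_real q * w j) ^ k))\<^sup>2 + \<delta>)"
      unfolding \<delta>_def using q by (intro sum_mono pointwise) (simp add: norm_mult w_def)
    also have "\<dots> = q\<^sup>2 * (real (Suc n) * (K\<^sup>2 + \<alpha>\<^sup>2 * S n)) + real (Suc n) * \<delta>"
      unfolding sum.distrib sum_distrib_left[symmetric] parseval
      by (simp add: S_def f_def sum.lessThan_Suc_shift norm_mult \<alpha>_def sum_distrib_left
          power_mult_distrib mult_ac del: sum.lessThan_Suc)
    also have "\<dots> = real (Suc n) * (q\<^sup>2 * (K\<^sup>2 + \<alpha>\<^sup>2 * S n) + \<delta>)"
      by (simp add: algebra_simps)
    finally have "S n \<le> q\<^sup>2 * (K\<^sup>2 + \<alpha>\<^sup>2 * S n) + \<delta>"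
      by (simp only: mult_le_cancel_left_pos of_nat_0_less_iff zero_less_Suc)
    then show ?thesis
      by (simp add: \<delta>_def algebra_simps)
  qed
  have coeff: "0 \<le> 1 - q\<^sup>2 * \<alpha>\<^sup>2"
    using q \<alpha> by (simp add: power_mult_distrib[symmetric] power_le_one mult_le_one)
  have "(\<lambda>n. q\<^sup>2 * K\<^sup>2 + (4 * e (Suc n) * (1 + B) + 4 * (e (Suc n))\<^sup>2))
      \<longlonglongrightarrow> q\<^sup>2 * K\<^sup>2 + (4 * 0 * (1 + B) + 4 * 0\<^sup>2)"
    by (intro tendsto_intros LIMSEQ_Suc[OF e_lim])
  moreover have "(1 - q\<^sup>2 * \<alpha>\<^sup>2) * S N
      \<le> q\<^sup>2 * K\<^sup>2 + (4 * e (Suc n) * (1 + B) + 4 * (e (Suc n))\<^sup>2)" if "n \<ge> N" for n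
  proof -
    have "S N \<le> S n"
      unfolding S_def using that by (intro sum_mono2) auto
    then show ?thesis
      using mult_left_mono[OF _ coeff] bound[of n] order_trans by blast
  qed
  ultimately have "(1 - q\<^sup>2 * \<alpha>\<^sup>2) * S N \<le> q\<^sup>2 * K\<^sup>2 + (4 * 0 * (1 + B) + 4 * 0\<^sup>2)"
    by (intro LIMSEQ_le_const) auto
  then show ?thesis
    by (simp add: S_def f_def K_def \<alpha>_def)
qed

section \<open>The inequality for one function\<close>

text \<open>
  Clearing the denominator leaves a quartic with a double zero at \<open>3/8\<close>; its cofactor
  \<open>(- 32 t\<^sup>2 + 16 t + 23) / 15\<close> is positive on the interval.
\<close>
lemma tangent_bound_at_three_eighths:
  fixes t :: real
  assumes "0 \<le> t" "t \<le> 1 / 2"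
  shows "t + (1 - 32 / 7 * t\<^sup>2) * (7 / 64 / (1 - 8 / 3 * t\<^sup>2) + 7 / 40) \<le> 1 / 2"
proof -
  define D where "D = 1 - 8 / 3 * t\<^sup>2"
  have "t\<^sup>2 \<le> 1 / 4"
    using power_mono[OF assms(2) assms(1), of 2] by (simp add: power_divide)
  then have D: "D > 0" and quad: "0 \<le> - 32 * t\<^sup>2 + 16 * t + 23"
    using assms by (simp_all add: D_def)
  have "(1 / 2 - t) * D - (1 - 32 / 7 * t\<^sup>2) * (7 / 64 + 7 / 40 * D)
      = (t - 3 / 8)\<^sup>2 * (- 32 * t\<^sup>2 + 16 * t + 23) / 15"
    unfolding D_def by (simp add: power2_eq_square field_simps)
  also have "\<dots> \<ge> 0"
    using quad by simp
  finally have "(1 - 32 / 7 * t\<^sup>2) * (7 / 64 + 7 / 40 * D) \<le> (1 / 2 - t) * D"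
    by simp
  then have "(1 - 32 / 7 * t\<^sup>2) * ((7 / 64 + 7 / 40 * D) / D) \<le> 1 / 2 - t"
    using D by (simp add: divide_le_eq)
  moreover have "(7 / 64 + 7 / 40 * D) / D = 7 / 64 / D + 7 / 40"
    using D by (simp add: field_simps)
  ultimately have "(1 - 32 / 7 * t\<^sup>2) * (7 / 64 / D + 7 / 40) \<le> 1 / 2 - t"
    by (simp only:)
  then show ?thesis
    unfolding D_def[symmetric] by linarith
qed

text \<open>
  Split \<open>r = q p\<close> with \<open>q\<^sup>2 = 7/12\<close> and \<open>p\<^sup>2 = 3/8\<close>, and estimate \<open>|c\<^sub>k| r\<^sup>k = (|c\<^sub>k| q\<^sup>k) p\<^sup>k\<close> by the
  weighted arithmetic-geometric mean inequality with weight \<open>\<mu> / (1 - \<alpha>\<^sup>2)\<close>, where \<open>\<alpha> = |c 0|\<close>.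
  The extremal function has \<open>c 0 = s\<close> and \<open>|c\<^sub>k| = (1 - s\<^sup>2) s\<^sup>k\<^sup>-\<^sup>1\<close> with \<open>s = 3 / sqrt 14\<close>.
  Equality there requires \<open>s q = p\<close> and \<open>\<mu> = s\<close>, which with \<open>q p = r = sqrt (7/32)\<close> determines
  \<open>q\<close>, \<open>p\<close> and \<open>\<mu>\<close>. These values serve for every \<open>\<alpha>\<close>.
\<close>
lemma sum_norm_coeff_le_half:
  fixes c :: "nat \<Rightarrow> complex"
  assumes sums: "\<And>z. norm z < 1 \<Longrightarrow> (\<lambda>n. c n * z ^ n) sums \<phi> z"
    and lt1: "\<And>z. norm z < 1 \<Longrightarrow> norm (\<phi> z) < 1"
  shows "(\<Sum>k<N. norm (c k) * sqrt (7 / 32) ^ Suc k) \<le> 1 / 2"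
proof -
  define r where "r = sqrt (7 / 32 :: real)"
  define q where "q = sqrt (7 / 12 :: real)"
  define p where "p = sqrt (3 / 8 :: real)"
  \<comment> \<open>This is \<open>3 / sqrt 14\<close>.\<close>
  define \<mu> where "\<mu> = 3 / 8 / r"
  define \<alpha> where "\<alpha> = norm (c 0)"
  define t where "t = r * \<alpha>"
  define K where "K = 1 - \<alpha>\<^sup>2"
  define D where "D = 1 - 7 / 12 * \<alpha>\<^sup>2"
  have r: "0 < r" "r\<^sup>2 = 7 / 32" and q: "0 < q" "q < 1" "q\<^sup>2 = 7 / 12"
    and p: "0 < p" "p\<^sup>2 = 3 / 8" and rqp: "r = q * p"
    by (simp_all add: r_def q_def p_def real_sqrt_mult[symmetric])
  have r_half: "r \<le> 1 / 2"
    unfolding r_def by (rule real_le_lsqrt) (simp_all add: power_divide)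
  have \<mu>: "0 < \<mu>" "r * \<mu> = 3 / 8" "r / \<mu> = 7 / 12"
    using r by (simp_all add: \<mu>_def power2_eq_square field_simps)
  have "norm (\<phi> 0) < 1" "\<phi> 0 = c 0"
    using lt1[of 0] sums[of 0] by (simp_all add: sums_iff powser_zero)
  then have \<alpha>: "0 \<le> \<alpha>" "\<alpha> < 1" "\<alpha>\<^sup>2 < 1"
    by (auto simp: \<alpha>_def power_less_one_iff)
  then have K: "0 < K" and D: "0 < D"
    by (auto simp: K_def D_def)
  have "D * (\<Sum>k<N. (norm (c (Suc k)) * q ^ Suc k)\<^sup>2) \<le> 7 / 12 * K\<^sup>2"
    using sum_coeff_squares_le[OF sums lt1 q(1,2), of N] by (simp add: q D_def K_def \<alpha>_def)
  then have energy: "(\<Sum>k<N. (norm (c (Suc k)) * q ^ Suc k)\<^sup>2) \<le> 7 / 12 * K\<^sup>2 / D"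
    using D by (simp add: le_divide_eq mult_ac)
  have geom: "(\<Sum>k<N. (p ^ Suc k)\<^sup>2) \<le> 3 / 5"
  proof -
    have "(\<Sum>k<N. (p ^ Suc k)\<^sup>2) = (\<Sum>k<N. 3 / 8 * (3 / 8) ^ k)"
      by (simp add: power2_eq_square power_mult_distrib[symmetric] flip: p(2))
        (simp add: power2_eq_square power_mult_distrib mult_ac)
    also have "\<dots> = 3 / 8 * (\<Sum>k<N. (3 / 8) ^ k)"
      by (simp only: sum_distrib_left)
    also have "\<dots> \<le> 3 / 8 * (8 / 5)"
      using geometric_sum_less[of "3 / 8 :: real" "{..<N}"] by simp
    finally show ?thesis by simp
  qed
  have "(\<Sum>k<N. norm (c (Suc k)) * r ^ Suc k)
      \<le> (\<Sum>k<N. \<mu> / K / 2 * (norm (c (Suc k)) * q ^ Suc k)\<^sup>2 + K / \<mu> / 2 * (p ^ Suc k)\<^sup>2)"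
  proof (rule sum_mono)
    fix k
    define x where "x = norm (c (Suc k)) * q ^ Suc k"
    define y where "y = p ^ Suc k"
    have "0 \<le> (\<mu> * x - K * y)\<^sup>2"
      by simp
    then have "x * y \<le> \<mu> / K / 2 * x\<^sup>2 + K / \<mu> / 2 * y\<^sup>2"
      using K \<mu>(1) by (simp add: power2_eq_square field_simps)
    then show "norm (c (Suc k)) * r ^ Suc k
        \<le> \<mu> / K / 2 * (norm (c (Suc k)) * q ^ Suc k)\<^sup>2 + K / \<mu> / 2 * (p ^ Suc k)\<^sup>2"
      by (simp add: x_def y_def rqp power_mult_distrib mult_ac)
  qed
  also have "\<dots> = \<mu> / K / 2 * (\<Sum>k<N. (norm (c (Suc k)) * q ^ Suc k)\<^sup>2)
      + K / \<mu> / 2 * (\<Sum>k<N. (p ^ Suc k)\<^sup>2)"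
    by (simp only: sum.distrib sum_distrib_left)
  also have "\<dots> \<le> \<mu> / K / 2 * (7 / 12 * K\<^sup>2 / D) + K / \<mu> / 2 * (3 / 5)"
    using energy geom K \<mu>(1) by (intro add_mono mult_left_mono) auto
  finally have tail: "(\<Sum>k<N. norm (c (Suc k)) * r ^ Suc k)
      \<le> \<mu> / K / 2 * (7 / 12 * K\<^sup>2 / D) + K / \<mu> / 2 * (3 / 5)" .
  have "(\<Sum>k<N. norm (c k) * r ^ Suc k) \<le> (\<Sum>k<Suc N. norm (c k) * r ^ Suc k)"
    using r by simp
  also have "\<dots> = t + r * (\<Sum>k<N. norm (c (Suc k)) * r ^ Suc k)"
    by (simp add: sum.lessThan_Suc_shift t_def \<alpha>_def sum_distrib_left mult_ac del: sum.lessThan_Suc)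
  also have "\<dots> \<le> t + r * (\<mu> / K / 2 * (7 / 12 * K\<^sup>2 / D) + K / \<mu> / 2 * (3 / 5))"
    using tail r by simp
  also have "r * (\<mu> / K / 2 * (7 / 12 * K\<^sup>2 / D) + K / \<mu> / 2 * (3 / 5))
      = K * ((r * \<mu>) * (7 / 24) / D + (r / \<mu>) * (3 / 10))"
    using K D \<mu>(1) by (simp add: power2_eq_square field_simps)
  also have "\<dots> = K * (7 / 64 / D + 7 / 40)"
    by (simp add: \<mu>)
  also have "K = 1 - 32 / 7 * t\<^sup>2"
    by (simp add: K_def t_def power_mult_distrib r)
  also have "D = 1 - 8 / 3 * t\<^sup>2"
    by (simp add: D_def t_def power_mult_distrib r)
  also have "t + (1 - 32 / 7 * t\<^sup>2) * (7 / 64 / (1 - 8 / 3 * t\<^sup>2) + 7 / 40) \<le> 1 / 2"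
  proof (rule tangent_bound_at_three_eighths)
    show "0 \<le> t" "t \<le> 1 / 2"
      using r r_half \<alpha> mult_mono[of r "1/2" \<alpha> 1] by (auto simp: t_def)
  qed
  finally show ?thesis
    by (simp add: r_def)
qed

text \<open>
  Dividing out the zero at the origin does not increase the bound, by the Schwarz lemma; its
  derivative part covers \<open>z = 0\<close>.
\<close>
lemma norm_le_of_norm_mult_id_less:
  fixes \<phi> :: "complex \<Rightarrow> complex"
  assumes hol: "\<phi> holomorphic_on unit_disk"
    and lt: "\<And>z. norm z < 1 \<Longrightarrow> norm (z * \<phi> z) < H"
    and z: "norm z < 1"
  shows "norm (\<phi> z) \<le> H"
proof -
  have H: "0 < H"
    using lt[of 0] by simp
  define f where "f \<zeta> = \<zeta> * \<phi> \<zeta> / H" for \<zeta>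
  have hf: "f holomorphic_on unit_disk"
    unfolding f_def using H by (intro holomorphic_intros hol) auto
  have f0: "f 0 = 0"
    by (simp add: f_def)
  have f1: "norm (f \<zeta>) < 1" if "norm \<zeta> < 1" for \<zeta>
    using lt[OF that] H by (simp add: f_def norm_divide)
  note schwarz = Schwarz_Lemma(1,2)[OF hf f0 f1 z]
  show ?thesis
  proof (cases "z = 0")
    case True
    have "(\<phi> has_field_derivative deriv \<phi> 0) (at 0)"
      using hol by (intro holomorphic_derivI[of _ unit_disk]) auto
    then have "(f has_field_derivative \<phi> 0 / H) (at 0)"
      unfolding f_def using H by (auto intro!: derivative_eq_intros)
    then have "norm (\<phi> 0 / H) \<le> 1"
      using schwarz(2) by (simp add: DERIV_imp_deriv)
    then show ?thesis
      using H True by (simp add: norm_divide)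
  next
    case False
    then show ?thesis
      using schwarz(1) H by (simp add: f_def norm_divide norm_mult divide_le_eq)
  qed
qed

lemma norm_le_disk_sup_norm:
  assumes "bounded (h ` unit_disk)" "norm z < 1"
  shows "norm (h z) \<le> disk_sup_norm h"
  unfolding disk_sup_norm_def using assms
  by (intro cSUP_upper) (auto simp: bounded_iff bdd_above_def)

text \<open>
  Dividing \<open>\<phi>\<close> by a number strictly larger than the norm, instead of the norm itself, makes it map
  into the open disc. This avoids a separate treatment of \<open>h = 0\<close> and of the rotations
  \<open>h(z) = c z\<close>, for which \<open>\<phi>\<close> is constant of maximal modulus.
\<close>
lemma sum_norm_coeff_le_half_sup:
  assumes h: "bounded_analytic_series a h" and r: "0 \<le> r" "r \<le> sqrt (7 / 32)"
  shows "(\<Sum>n<N. norm (a (Suc n)) * r ^ Suc n) \<le> disk_sup_norm h / 2"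
proof (rule field_le_epsilon)
  fix e :: real
  assume e: "0 < e"
  define H where "H = disk_sup_norm h + 2 * e"
  have h_sums: "(\<lambda>n. a (Suc n) * z ^ Suc n) sums h z" if "norm z < 1" for z
    using h that by (simp add: bounded_analytic_series_def)
  have h_le: "norm (h z) \<le> disk_sup_norm h" if "norm z < 1" for z
    using h that by (simp add: bounded_analytic_series_def norm_le_disk_sup_norm)
  have "0 \<le> disk_sup_norm h"
    using h_le[of 0] by (intro order_trans[OF norm_ge_zero[of "h 0"]]) simp
  then have H: "0 < H"
    using e by (simp add: H_def)
  define \<phi> where "\<phi> z = (\<Sum>n. a (Suc n) * z ^ n)" for z
  have \<phi>_sums: "(\<lambda>n. a (Suc n) * z ^ n) sums \<phi> z" if "norm z < 1" for z
  proof (cases "z = 0")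
    case True
    have "(\<lambda>n. a (Suc n) * 0 ^ n) sums a (Suc 0)"
      using powser_sums_zero[of "\<lambda>n. a (Suc n)"] by simp
    then show ?thesis
      using True by (auto simp: \<phi>_def sums_iff)
  next
    case False
    have "summable (\<lambda>n. inverse z * (a (Suc n) * z ^ Suc n))"
      using h_sums[OF that] by (intro summable_mult) (rule sums_summable)
    then show ?thesis
      using False unfolding \<phi>_def by (intro summable_sums) (simp add: mult_ac)
  qed
  have hol: "\<phi> holomorphic_on unit_disk"
    using \<phi>_sums by (intro power_series_holomorphic[where a = "\<lambda>n. a (Suc n)"]) (auto simp: dist_norm)
  have h_eq: "h z = z * \<phi> z" if "norm z < 1" for z
    using sums_mult[OF \<phi>_sums[OF that], of z] h_sums[OF that]
    by (simp add: sums_iff mult_ac)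
  have \<phi>_lt: "norm (\<phi> z) < H" if "norm z < 1" for z
  proof -
    have "norm (\<zeta> * \<phi> \<zeta>) < disk_sup_norm h + e" if "norm \<zeta> < 1" for \<zeta>
      using h_le[OF that] h_eq[OF that] e by simp
    then have "norm (\<phi> z) \<le> disk_sup_norm h + e"
      using norm_le_of_norm_mult_id_less[OF hol _ that] by blast
    then show ?thesis
      using e by (simp add: H_def)
  qed
  have "(\<Sum>n<N. norm (a (Suc n)) * r ^ Suc n) \<le> (\<Sum>n<N. norm (a (Suc n)) * sqrt (7 / 32) ^ Suc n)"
    using r by (intro sum_mono mult_left_mono power_mono) auto
  also have "\<dots> = H * (\<Sum>n<N. norm (a (Suc n) / H) * sqrt (7 / 32) ^ Suc n)"
    using H by (simp add: sum_distrib_left norm_divide)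
  also have "\<dots> \<le> H * (1 / 2)"
  proof (intro mult_left_mono sum_norm_coeff_le_half[where \<phi> = "\<lambda>z. \<phi> z / H"])
    show "(\<lambda>n. a (Suc n) / H * z ^ n) sums (\<phi> z / H)" if "norm z < 1" for z
      using sums_divide[OF \<phi>_sums[OF that], of H] by (simp add: field_simps)
    show "norm (\<phi> z / H) < 1" if "norm z < 1" for z
      using \<phi>_lt[OF that] H by (simp add: norm_divide)
  qed (use H in simp)
  finally show "(\<Sum>n<N. norm (a (Suc n)) * r ^ Suc n) \<le> disk_sup_norm h / 2 + e"
    by (simp add: H_def field_simps)
qed

section \<open>The extremal function\<close>

text \<open>
  The Taylor coefficients of \<open>(s - z) / (1 - s z)\<close> are \<open>s\<close> followed by the geometric sequence
  \<open>- (1 - s\<^sup>2) s\<^sup>k\<close>.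
\<close>
lemma bounded_analytic_series_mult_Moebius:
  fixes s :: real
  assumes s: "0 \<le> s" "s < 1"
  defines "a \<equiv> \<lambda>n. case n of 0 \<Rightarrow> 0 | Suc 0 \<Rightarrow> complex_of_real s
                       | Suc (Suc k) \<Rightarrow> - of_real ((1 - s\<^sup>2) * s ^ k)"
    and "h \<equiv> \<lambda>z. z * ((of_real s - z) / (1 - of_real s * z))"
  shows "bounded_analytic_series a h" and "disk_sup_norm h \<le> 1"
    and "\<And>r. \<lbrakk>0 \<le> r; r < 1\<rbrakk> \<Longrightarrow> (\<lambda>n. norm (a (Suc n)) * r ^ Suc n) sums
           (s * r + (1 - s\<^sup>2) * r\<^sup>2 / (1 - s * r))"
proof -
  have sz: "norm (of_real s * z) < 1" if "norm z < 1" for z :: complex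
    using s that mult_left_le_one_le[of "norm z" s] by (simp add: norm_mult)
  have nz: "1 - of_real s * z \<noteq> 0" if "norm z < 1" for z :: complex
    using sz[OF that] by auto
  have h_le: "norm (h z) \<le> 1" if "norm z < 1" for z
  proof -
    have "norm (Moebius_function 0 (of_real s) z) < 1"
      using s that by (intro Moebius_function_norm_lt_1) auto
    then have "norm ((of_real s - z) / (1 - of_real s * z)) \<le> 1"
      by (simp add: Moebius_function_simple norm_divide norm_minus_commute)
    then show ?thesis
      using that unfolding h_def norm_mult by (intro mult_le_one) auto
  qed
  then show "disk_sup_norm h \<le> 1"
    unfolding disk_sup_norm_def by (intro cSUP_least) auto
  have "h holomorphic_on unit_disk"
    unfolding h_def using nz by (intro holomorphic_intros) auto
  then have "h analytic_on unit_disk"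
    by (simp add: analytic_on_open)
  moreover have "bounded (h ` unit_disk)"
    unfolding bounded_iff by (rule exI[of _ 1]) (use h_le in auto)
  moreover have "(\<lambda>n. a (Suc n) * z ^ Suc n) sums h z" if z: "norm z < 1" for z
  proof -
    have "(\<lambda>n. - (1 - of_real s ^ 2) * z\<^sup>2 * (of_real s * z) ^ n)
        sums (- (1 - of_real s ^ 2) * z\<^sup>2 * (1 / (1 - of_real s * z)))"
      by (intro sums_mult geometric_sums sz z)
    moreover have "(\<lambda>n. - (1 - of_real s ^ 2) * z\<^sup>2 * (of_real s * z) ^ n)
        = (\<lambda>n. a (Suc (Suc n)) * z ^ Suc (Suc n))"
      by (simp add: a_def fun_eq_iff power_mult_distrib power2_eq_square algebra_simps)
    ultimately have "(\<lambda>n. a (Suc (Suc n)) * z ^ Suc (Suc n))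
        sums (- (1 - of_real s ^ 2) * z\<^sup>2 * (1 / (1 - of_real s * z)))"
      by (simp only:)
    then have "(\<lambda>n. a (Suc n) * z ^ Suc n)
        sums (- (1 - of_real s ^ 2) * z\<^sup>2 * (1 / (1 - of_real s * z)) + a (Suc 0) * z ^ Suc 0)"
      by (rule sums_Suc)
    moreover have "- (1 - of_real s ^ 2) * z\<^sup>2 * (1 / (1 - of_real s * z)) + a (Suc 0) * z ^ Suc 0 = h z"
      using nz[OF z] by (simp add: a_def h_def field_simps power2_eq_square)
    ultimately show ?thesis by simp
  qed
  ultimately show "bounded_analytic_series a h"
    by (simp add: bounded_analytic_series_def)
  fix r :: real
  assume r: "0 \<le> r" "r < 1"
  have "norm (s * r) < 1"
    using s r mult_left_le_one_le[of r s] by simp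
  then have "(\<lambda>n. (1 - s\<^sup>2) * r\<^sup>2 * (s * r) ^ n) sums ((1 - s\<^sup>2) * r\<^sup>2 * (1 / (1 - s * r)))"
    by (intro sums_mult geometric_sums)
  moreover have "norm (a (Suc (Suc n))) = (1 - s\<^sup>2) * s ^ n" for n
    unfolding a_def using s by (simp add: norm_mult norm_power power_le_one abs_mult del: of_real_mult of_real_diff)
  ultimately have "(\<lambda>n. norm (a (Suc (Suc n))) * r ^ Suc (Suc n)) sums ((1 - s\<^sup>2) * r\<^sup>2 * (1 / (1 - s * r)))"
    by (simp add: power_mult_distrib power2_eq_square mult_ac)
  then have "(\<lambda>n. norm (a (Suc n)) * r ^ Suc n)
      sums ((1 - s\<^sup>2) * r\<^sup>2 * (1 / (1 - s * r)) + norm (a (Suc 0)) * r ^ Suc 0)"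
    by (rule sums_Suc)
  then show "(\<lambda>n. norm (a (Suc n)) * r ^ Suc n) sums (s * r + (1 - s\<^sup>2) * r\<^sup>2 / (1 - s * r))"
    using s by (simp add: a_def add.commute)
qed

text \<open>
  In terms of \<open>t = s r\<close> the claim becomes \<open>(t - 3/8) (4/3 - 4/9 t) > 0\<close>, and \<open>t > 3/8\<close> says exactly
  that \<open>r\<^sup>2 > 7/32\<close>.
\<close>
lemma half_less_extremal_sum:
  fixes r :: real
  assumes r: "sqrt (7 / 32) < r" "r < 1"
  defines "s \<equiv> 3 / sqrt 14"
  shows "0 \<le> s" "s < 1" "1 / 2 < s * r + (1 - s\<^sup>2) * r\<^sup>2 / (1 - s * r)"
proof -
  define t where "t = s * r"
  have r0: "0 \<le> sqrt (7 / 32 :: real)" by simp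
  show s0: "0 \<le> s" by (simp add: s_def)
  have s2: "s\<^sup>2 = 9 / 14" by (simp add: s_def power_divide)
  show s1: "s < 1"
    using s0 s2 power2_less_imp_less[of s 1] by simp
  have "s * sqrt (7 / 32) = 3 / 8"
  proof (rule power2_eq_imp_eq)
    show "(s * sqrt (7 / 32))\<^sup>2 = (3 / 8)\<^sup>2"
      by (simp add: power_mult_distrib s2 power_divide)
  qed (use s0 in auto)
  moreover have "s * sqrt (7 / 32) < s * r"
    using r by (intro mult_strict_left_mono) (simp_all add: s_def)
  ultimately have t: "3 / 8 < t" by (simp add: t_def)
  have "0 \<le> r"
    using r(1) r0 by linarith
  then have t1: "t < 1"
    using s0 s1 r(2) mult_left_le_one_le[of r s] by (simp add: t_def)
  have "r\<^sup>2 = 14 / 9 * t\<^sup>2"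
    by (simp add: t_def power_mult_distrib s2)
  then have eq: "(1 - s\<^sup>2) * r\<^sup>2 = 5 / 9 * t\<^sup>2"
    by (simp add: s2)
  have "0 < (t - 3 / 8) * (4 / 3 - 4 / 9 * t)"
    using t t1 by (intro mult_pos_pos) auto
  also have "(t - 3 / 8) * (4 / 3 - 4 / 9 * t) = t * (1 - t) + 5 / 9 * t\<^sup>2 - 1 / 2 * (1 - t)"
    by (simp add: power2_eq_square field_simps)
  finally have "1 / 2 * (1 - t) < t * (1 - t) + 5 / 9 * t\<^sup>2"
    by (simp only: diff_gt_0_iff_gt)
  then have "1 / 2 < (t * (1 - t) + 5 / 9 * t\<^sup>2) / (1 - t)"
    using t1 by (simp add: less_divide_eq)
  also have "\<dots> = t + 5 / 9 * t\<^sup>2 / (1 - t)"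
    using t1 by (simp add: add_divide_distrib)
  finally show "1 / 2 < s * r + (1 - s\<^sup>2) * r\<^sup>2 / (1 - s * r)"
    unfolding eq t_def[symmetric] .
qed

section \<open>The sharp Bohr radius for a pair of functions\<close>

theorem theorem4:
  "(\<forall>(f :: complex \<Rightarrow> complex) h g a b.
      ((\<forall>z\<in>unit_disk. f z = h z + g z) \<or> (\<forall>z\<in>unit_disk. f z = h z + cnj (g z))) \<longrightarrow>
      bounded_analytic_series a h \<longrightarrow> bounded_analytic_series b g \<longrightarrow>
      (\<forall>r::real. 0 \<le> r \<and> r \<le> sqrt (7 / 32) \<longrightarrow>
         summable (\<lambda>n. (norm (a (Suc n)) + norm (b (Suc n))) * r ^ Suc n) \<and>
         (\<Sum>n. (norm (a (Suc n)) + norm (b (Suc n))) * r ^ Suc n)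
           \<le> max (disk_sup_norm h) (disk_sup_norm g)))
   \<and>
   (\<forall>r::real. sqrt (7 / 32) < r \<and> r < 1 \<longrightarrow>
      (\<exists>h g a b.
         bounded_analytic_series a h \<and> bounded_analytic_series b g \<and>
         summable (\<lambda>n. (norm (a (Suc n)) + norm (b (Suc n))) * r ^ Suc n) \<and>
         (\<Sum>n. (norm (a (Suc n)) + norm (b (Suc n))) * r ^ Suc n)
           > max (disk_sup_norm h) (disk_sup_norm g)))"
proof (intro conjI[OF allI allI] allI impI; (elim conjE)?)
  fix h g :: "complex \<Rightarrow> complex" and a b :: "nat \<Rightarrow> complex" and r :: real
  assume h: "bounded_analytic_series a h" and g: "bounded_analytic_series b g"
    and r: "0 \<le> r" "r \<le> sqrt (7 / 32)"
  define u where "u n = (norm (a (Suc n)) + norm (b (Suc n))) * r ^ Suc n" for n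
  define M where "M = max (disk_sup_norm h) (disk_sup_norm g)"
  have partial: "(\<Sum>n<N. u n) \<le> M" for N
  proof -
    have "(\<Sum>n<N. u n) = (\<Sum>n<N. norm (a (Suc n)) * r ^ Suc n) + (\<Sum>n<N. norm (b (Suc n)) * r ^ Suc n)"
      by (simp only: u_def distrib_right sum.distrib)
    also have "\<dots> \<le> disk_sup_norm h / 2 + disk_sup_norm g / 2"
      by (intro add_mono sum_norm_coeff_le_half_sup h g r)
    also have "\<dots> \<le> M"
      by (simp add: M_def max_def)
    finally show ?thesis .
  qed
  have "summable u"
    using partial r by (intro summableI_nonneg_bounded) (auto simp: u_def)
  moreover from this have "suminf u \<le> M"
    using partial by (intro suminf_le_const)
  ultimately show "summable (\<lambda>n. (norm (a (Suc n)) + norm (b (Suc n))) * r ^ Suc n) \<and>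
         (\<Sum>n. (norm (a (Suc n)) + norm (b (Suc n))) * r ^ Suc n)
           \<le> max (disk_sup_norm h) (disk_sup_norm g)"
    unfolding u_def M_def by blast
next
  fix r :: real
  assume r: "sqrt (7 / 32) < r" "r < 1"
  have r0: "0 \<le> r"
    using r(1) real_sqrt_ge_zero[of "7 / 32"] by linarith
  note s = half_less_extremal_sum[OF r]
  define s where "s = 3 / sqrt (14 :: real)"
  note ex = bounded_analytic_series_mult_Moebius[OF s(1,2), folded s_def]
  obtain a h where ah: "bounded_analytic_series a h" "disk_sup_norm h \<le> 1"
    and sums: "(\<lambda>n. norm (a (Suc n)) * r ^ Suc n) sums (s * r + (1 - s\<^sup>2) * r\<^sup>2 / (1 - s * r))"
    using ex(1,2) ex(3)[OF r0 r(2)] by blast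
  have both: "(\<lambda>n. (norm (a (Suc n)) + norm (a (Suc n))) * r ^ Suc n)
      sums ((s * r + (1 - s\<^sup>2) * r\<^sup>2 / (1 - s * r)) + (s * r + (1 - s\<^sup>2) * r\<^sup>2 / (1 - s * r)))"
    using sums_add[OF sums sums] by (simp only: distrib_right)
  have "max (disk_sup_norm h) (disk_sup_norm h)
      < (\<Sum>n. (norm (a (Suc n)) + norm (a (Suc n))) * r ^ Suc n)"
    unfolding sums_unique[OF both, symmetric] using s(3)[folded s_def] ah(2) unfolding max.idem by linarith
  then show "\<exists>h g a b.
         bounded_analytic_series a h \<and> bounded_analytic_series b g \<and>
         summable (\<lambda>n. (norm (a (Suc n)) + norm (b (Suc n))) * r ^ Suc n) \<and>
         (\<Sum>n. (norm (a (Suc n)) + norm (b (Suc n))) * r ^ Suc n)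
           > max (disk_sup_norm h) (disk_sup_norm g)"
    using ah(1) sums_summable[OF both] by blast
qed

end
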